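(* Let $G$ be an abelian group. Then the following statements are equivalent. (a) $\mathcal{B}_{\pm}(G)$ is a Mori monoid. (b) $(\mathcal{B}_{\pm}(G) : \widehat{\mathcal{B}_{\pm}(G)})\neq\emptyset$. (c) $2G$ is finite. (d) $G=G_1\oplus G_2$, where $G_1$ is an elementary $2$-group and $G_2$ is a finite group. If these equivalent conditions are satisfied, then $\mathcal{B}_{\pm}(G)$ is seminormal if and only if $\exp(G)\mid 4$.
   Context: Groups are written additively. A monoid is a commutative cancellative semigroup with identity, written multiplicatively; $\mathsf{q}(H)$ denotes the quotient group of a monoid $H$. $\mathcal{F}(G)$ is the multiplicatively written free abelian monoid with basis $G$; its elements $S=g_1\cdot\ldots\cdot g_\ell$ (finite unordered sequences with repetition allowed) are called sequences over $G$. $\mathcal{B}_{\pm}(G)\subset\mathcal{F}(G)$ is the submonoid of all plus-minus weighted zero-sum sequences, i.e. all $S=g_1\cdot\ldots\cdot g_\ell$ for which there are $\varepsilon_1,\ldots,\varepsilon_\ell\in\{-1,1\}$ with $\varepsilon_1g_1+\ldots+\varepsilon_\ell g_\ell=0$ in $G$ (the empty sequence is included). For a monoid $H$: for subsets $I,J\subset\mathsf{q}(H)$, $(I:J)=\{x\in\mathsf{q}(H)\colon xJ\subset I\}$, $I^{-1}=(H:I)$, $I_v=(I^{-1})^{-1}$. A subset $I\subset H$ is a divisorial ideal if $I=I_v$. $H$ is a Mori monoid if it satisfies the ascending chain condition on divisorial ideals. The complete integral closure is $\widehat{H}=\{x\in\mathsf{q}(H)\colon \text{there is } c\in H \text{ with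 } cx^n\in H\text{ for all }n\in\mathbb{N}\}$. The seminormal closure is $H'=\{x\in\mathsf{q}(H)\colon\text{there is some }n\in\mathbb{N}\text{ with }x^m\in H\text{ for all }m\ge n\}$, and $H$ is seminormal if $H=H'$. $2G=\{2g\colon g\in G\}$; $G_1$ is an elementary $2$-group if $2G_1=0$; $\exp(G)\in\mathbb{N}\cup\{\infty\}$ is the exponent of $G$. Here $\mathbb{N}$ denotes the positive integers. *)

theory Defs
  imports
    Main
    "HOL-Library.Multiset"
    "HOL-Library.Poly_Mapping"
    "HOL-Library.Extended_Nat"
begin

section \<open>Multiples in additive groups\<close>

primrec nat_mult :: "nat \<Rightarrow> 'a::ab_group_add \<Rightarrow> 'a" where
  "nat_mult 0 x = 0"
| "nat_mult (Suc n) x = x + nat_mult n x"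

definition int_mult :: "int \<Rightarrow> 'a::ab_group_add \<Rightarrow> 'a" where
  "int_mult k x = (if 0 \<le> k then nat_mult (nat k) x else - nat_mult (nat (- k)) x)"

lemma int_mult_one [simp]: "int_mult 1 x = x"
  and int_mult_minus_one [simp]: "int_mult (- 1) x = - x"
  by (simp_all add: int_mult_def)

section \<open>Abelian groups\<close>

definition is_subgroup :: "'a::ab_group_add set \<Rightarrow> bool" where
  "is_subgroup A \<longleftrightarrow> 0 \<in> A \<and> (\<forall>a\<in>A. \<forall>b\<in>A. a + b \<in> A) \<and> (\<forall>a\<in>A. - a \<in> A)"

definition double :: "'a::ab_group_add set \<Rightarrow> 'a set" where
  "double A = {nat_mult 2 a | a. a \<in> A}"

definition elementary_2_group :: "'a::ab_group_add set \<Rightarrow> bool" where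
  "elementary_2_group A \<longleftrightarrow> double A = {0}"

definition direct_sum :: "'a::ab_group_add set \<Rightarrow> 'a set \<Rightarrow> 'a set \<Rightarrow> bool" where
  "direct_sum G A B \<longleftrightarrow>
     is_subgroup A \<and> is_subgroup B \<and> G = {a + b | a b. a \<in> A \<and> b \<in> B} \<and> A \<inter> B = {0}"

text \<open>On \<^typ>\<open>enat\<close> we have \<open>\<not> \<infinity> dvd 4\<close>, so divisibility has its usual meaning.\<close>

definition exponent :: "'a::ab_group_add set \<Rightarrow> enat" where
  "exponent G =
     (if \<exists>n>0. \<forall>g\<in>G. nat_mult n g = 0
      then enat (LEAST n. n > 0 \<and> (\<forall>g\<in>G. nat_mult n g = 0)) else \<infinity>)"

lemma not_infinity_dvd_4: "\<not> (\<infinity>::enat) dvd 4"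
proof
  assume "(\<infinity>::enat) dvd 4"
  then obtain k :: enat where k: "4 = \<infinity> * k" by (elim dvdE)
  show False
  proof (cases "k = 0")
    case True
    with k show False by simp
  next
    case False
    then have "\<infinity> * k = \<infinity>" by (simp add: imult_is_infinity)
    with k have "(4::enat) = \<infinity>" by simp
    then show False using numeral_ne_infinity by blast
  qed
qed

section \<open>Monoids and their quotient groups\<close>

text \<open>
  A monoid \<open>H\<close> is given as a submonoid of an abelian group, written additively, and its
  quotient group is realised inside that group. Thus the products \<open>x y\<close> and powers \<open>x^n\<close>
  of the multiplicative notation become \<open>x + y\<close> and \<^term>\<open>nat_mult n x\<close>.
  The ambient group plays no role beyond this: all notions are relative to
  the quotient group of \<open>H\<close>.
\<close>

definition is_submonoid :: "'b::ab_group_add set \<Rightarrow> bool" where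
  "is_submonoid H \<longleftrightarrow> 0 \<in> H \<and> (\<forall>a\<in>H. \<forall>b\<in>H. a + b \<in> H)"

definition quotient_group :: "'b::ab_group_add set \<Rightarrow> 'b set" where
  "quotient_group H = {a - b | a b. a \<in> H \<and> b \<in> H}"

text \<open>\<open>colon H I J\<close> is \<open>(I : J)\<close>, formed in the quotient group of \<open>H\<close>.\<close>

definition colon :: "'b::ab_group_add set \<Rightarrow> 'b set \<Rightarrow> 'b set \<Rightarrow> 'b set" where
  "colon H I J = {x \<in> quotient_group H. \<forall>y\<in>J. x + y \<in> I}"

definition inverse_ideal :: "'b::ab_group_add set \<Rightarrow> 'b set \<Rightarrow> 'b set" where
  "inverse_ideal H I = colon H H I"

definition v_closure :: "'b::ab_group_add set \<Rightarrow> 'b set \<Rightarrow> 'b set" where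
  "v_closure H I = inverse_ideal H (inverse_ideal H I)"

definition divisorial_ideal :: "'b::ab_group_add set \<Rightarrow> 'b set \<Rightarrow> bool" where
  "divisorial_ideal H I \<longleftrightarrow> I \<subseteq> H \<and> v_closure H I = I"

definition mori_monoid :: "'b::ab_group_add set \<Rightarrow> bool" where
  "mori_monoid H \<longleftrightarrow> is_submonoid H \<and>
     (\<forall>I :: nat \<Rightarrow> 'b set. (\<forall>n. divisorial_ideal H (I n)) \<and> (\<forall>n. I n \<subseteq> I (Suc n))
        \<longrightarrow> (\<exists>N. \<forall>n\<ge>N. I n = I N))"

definition complete_integral_closure :: "'b::ab_group_add set \<Rightarrow> 'b set" where
  "complete_integral_closure H =
     {x \<in> quotient_group H. \<exists>c\<in>H. \<forall>n\<ge>1. c + nat_mult n x \<in> H}"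

definition seminormal_closure :: "'b::ab_group_add set \<Rightarrow> 'b set" where
  "seminormal_closure H =
     {x \<in> quotient_group H. \<exists>n\<ge>1. \<forall>m\<ge>n. nat_mult m x \<in> H}"

definition seminormal :: "'b::ab_group_add set \<Rightarrow> bool" where
  "seminormal H \<longleftrightarrow> H = seminormal_closure H"

section \<open>Plus-minus weighted zero-sum sequences\<close>

definition plus_minus_zero_sum :: "'a::ab_group_add multiset \<Rightarrow> bool" where
  "plus_minus_zero_sum S \<longleftrightarrow>
     (\<exists>(gs :: 'a list) (\<epsilon> :: nat \<Rightarrow> int).
        mset gs = S \<and> (\<forall>i<length gs. \<epsilon> i \<in> {-1, 1}) \<and>
        (\<Sum>i<length gs. int_mult (\<epsilon> i) (gs ! i)) = 0)"

text \<open>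
  The free abelian monoid with basis \<^typ>\<open>'a\<close> is \<^typ>\<open>'a multiset\<close>. Its quotient
  group is the free abelian group \<^typ>\<open>'a \<Rightarrow>\<^sub>0 int\<close>, into which it embeds by \<open>frag_of_mset\<close>.
\<close>

definition frag_of_mset :: "'a multiset \<Rightarrow> 'a \<Rightarrow>\<^sub>0 int" where
  "frag_of_mset S = (\<Sum>g\<in>#S. frag_of g)"

text \<open>\<open>B_pm TYPE('a)\<close> is the monoid \<open>\<B>\<^sub>\<plusminus>(G)\<close> for the group \<open>G\<close> given by the type \<^typ>\<open>'a\<close>.\<close>

definition B_pm :: "'a::ab_group_add itself \<Rightarrow> ('a \<Rightarrow>\<^sub>0 int) set" where
  "B_pm _ = {frag_of_mset S | S :: 'a multiset. plus_minus_zero_sum S}"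

lemma frag_of_mset_empty [simp]: "frag_of_mset {#} = 0"
  and frag_of_mset_add: "frag_of_mset (S + T) = frag_of_mset S + frag_of_mset T"
  by (simp_all add: frag_of_mset_def)

lemma lookup_frag_of_mset: "Poly_Mapping.lookup (frag_of_mset S) g = int (count S g)"
  by (induction S) (auto simp: frag_of_mset_def lookup_add lookup_single)

lemma inj_frag_of_mset: "inj frag_of_mset"
  by (intro injI multiset_eqI) (metis lookup_frag_of_mset of_nat_eq_iff)

lemma plus_minus_zero_sum_empty: "plus_minus_zero_sum {#}"
  by (auto simp: plus_minus_zero_sum_def)

lemma plus_minus_zero_sum_add:
  assumes "plus_minus_zero_sum S" "plus_minus_zero_sum T"
  shows "plus_minus_zero_sum (S + T)"
proof -
  obtain xs d where x: "mset xs = S" "\<forall>i<length xs. d i \<in> {-1, 1::int}"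
      "(\<Sum>i<length xs. int_mult (d i) (xs ! i)) = 0"
    using assms(1) unfolding plus_minus_zero_sum_def by blast
  obtain ys e where y: "mset ys = T" "\<forall>i<length ys. e i \<in> {-1, 1::int}"
      "(\<Sum>i<length ys. int_mult (e i) (ys ! i)) = 0"
    using assms(2) unfolding plus_minus_zero_sum_def by blast
  define f where "f = (\<lambda>i. if i < length xs then d i else e (i - length xs))"
  have split: "(\<Sum>i<m + n. h i) = (\<Sum>i<m. h i) + (\<Sum>i<n. h (m + i))" for h :: "nat \<Rightarrow> 'a" and m n
    by (induction n) (simp_all add: add.assoc)
  have "(\<Sum>i<length (xs @ ys). int_mult (f i) ((xs @ ys) ! i)) = 0"
    using x(3) y(3) by (simp add: split f_def nth_append)
  moreover have "\<forall>i<length (xs @ ys). f i \<in> {-1, 1}"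
    using x(2) y(2) by (auto simp: f_def)
  moreover have "mset (xs @ ys) = S + T"
    using x(1) y(1) by simp
  ultimately show ?thesis
    unfolding plus_minus_zero_sum_def by blast
qed

lemma is_submonoid_B_pm: "is_submonoid (B_pm TYPE('a::ab_group_add))"
  unfolding is_submonoid_def B_pm_def
proof (intro conjI ballI)
  show "0 \<in> {frag_of_mset S |S :: 'a multiset. plus_minus_zero_sum S}"
    by (intro CollectI exI[of _ "{#}"]) (simp add: plus_minus_zero_sum_empty)
next
  fix a b :: "'a \<Rightarrow>\<^sub>0 int"
  assume "a \<in> {frag_of_mset S |S :: 'a multiset. plus_minus_zero_sum S}"
    and "b \<in> {frag_of_mset S |S :: 'a multiset. plus_minus_zero_sum S}"
  then obtain S T :: "'a multiset" where "a = frag_of_mset S" "b = frag_of_mset T"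
    "plus_minus_zero_sum S" "plus_minus_zero_sum T"
    by blast
  then show "a + b \<in> {frag_of_mset S |S :: 'a multiset. plus_minus_zero_sum S}"
    by (intro CollectI exI[of _ "S + T"]) (simp add: frag_of_mset_add plus_minus_zero_sum_add)
qed

end

theory Submission
  imports Defs
begin

text \<open>
Changing the signs of a subsequence \<open>T\<close> of \<open>S\<close> lowers the sum by twice the sum of \<open>T\<close>, so
\<open>S\<close> is a plus-minus zero-sum sequence exactly if its sum is a subsequence sum of the sequence
of doubled letters \<open>2g\<close>. This makes \<open>2G\<close> the group that governs the whole theorem, and it has two
immediate consequences for the monoid \<open>H\<close> of all such sequences. Every square lies in \<open>H\<close>, and a
sequence whose sum is \<open>2h\<close> enters \<open>H\<close> as soon as it is multiplied by \<open>h\<^sup>2\<close>. Hence both the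
quotient group and the complete integral closure are cut out by the single condition that the
sum lies in \<open>2G\<close> (\<open>frag_of_mset_in_quotient_iff\<close>, \<open>complete_integral_closure_B_pm\<close>).

Conductor. An element \<open>T\<close> of the conductor turns the one-letter sequence \<open>2h\<close> into a zero-sum
sequence, so \<open>2h\<close> is one of the finitely many signed sums of \<open>T\<close>. Conversely, if \<open>2G\<close> is finite,
the product of \<open>h\<^sup>2\<close> over one \<open>h\<close> for each element \<open>2h\<close> of \<open>2G\<close> lies in the conductor
(\<open>conductor_nonempty_iff\<close>).

Mori property. By \<open>mori_monoid_iff\<close> the ascending chain condition says that there are no
elements \<open>a\<^sub>n\<close> of \<open>H\<close> and \<open>y\<^sub>n\<close> of its quotient group for which \<open>y\<^sub>n a\<^sub>m\<close> lies in \<open>H\<close> for all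
\<open>m < n\<close> but not for \<open>m = n\<close>. If \<open>2G\<close> is finite, Dickson's lemma applies although \<open>G\<close> may
have infinitely many letters: only the letters of \<open>a\<^sub>0\<close> can occur in \<open>y\<^sub>n\<close>, for \<open>n \<ge> 1\<close>, with negative
exponent, and for the zero-sum condition only the images of the letters in the finite group
\<open>2G\<close> count (\<open>mori_if_finite_double\<close>). If \<open>2G\<close> is infinite, bad sequences \<open>y\<^sub>n = b k\<^sub>0\<^sup>2 \<dots> k\<^sub>n\<^sub>-\<^sub>1\<^sup>2\<close>
and \<open>a\<^sub>n = (e + k\<^sub>n)\<^sup>2\<close> with \<open>b = 2e \<noteq> 0\<close> are chosen greedily. A finite sequence has only
finitely many signed sums, so at each step all but finitely many values of \<open>2k\<^sub>n\<close> are
admissible, whatever the structure of \<open>G\<close> (\<open>finite_double_if_mori\<close>).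

Direct sum. If \<open>2G\<close> is finite, there is a finite subgroup \<open>K\<close> such that every element of \<open>2G\<close> is
twice an element of \<open>K\<close>. Then \<open>K\<close> together with the elements of order at most two generates
\<open>G\<close>, and a maximal elementary 2-subgroup that meets \<open>K\<close> trivially is a complement of \<open>K\<close>
(\<open>complement_with_elementary_2_group\<close>).

Seminormality. For every \<open>g\<close> the square and the cube of \<open>g (3g)\<close>, hence all its higher powers,
lie in \<open>H\<close>, whereas \<open>g (3g)\<close> itself lies in \<open>H\<close> only if \<open>4g = 0\<close>. Conversely, if \<open>4G = 0\<close>, then
\<open>2(2G) = 0\<close>, so in a signed zero-sum representation of an odd power of \<open>S\<close> only the parities of
the multiplicities matter, and it can be reduced to one of \<open>S\<close>.
\<close>

section \<open>Signed sums\<close>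

text \<open>
The values \<open>\<plusminus>g\<^sub>1 \<plusminus> \<dots> \<plusminus> g\<^sub>l\<close>, with \<open>T\<close> as the subsequence of the letters with sign \<open>-1\<close>.
\<close>

definition signed_sums :: "'a::ab_group_add multiset \<Rightarrow> 'a set" where
  "signed_sums S = {sum_mset S - (sum_mset T + sum_mset T) | T. T \<subseteq># S}"

lemma signed_sums_empty [simp]: "signed_sums {#} = {0}"
  by (auto simp: signed_sums_def)

lemma signed_sums_union:
  "signed_sums (A + B) = {a + b | a b. a \<in> signed_sums A \<and> b \<in> signed_sums B}" (is "?L = ?R")
proof (intro equalityI subsetI)
  fix v assume "v \<in> ?L"
  then obtain T where T: "T \<subseteq># A + B" and v: "v = sum_mset (A + B) - (sum_mset T + sum_mset T)"
    unfolding signed_sums_def by blast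
  define U where "U = T \<inter># A"
  have U: "U \<subseteq># A" "T - A \<subseteq># B" and T_eq: "T = U + (T - A)"
    using T by (auto simp: U_def subset_eq_diff_conv add.commute multiset_eq_iff)
  have "sum_mset T = sum_mset U + sum_mset (T - A)"
    using T_eq by (metis sum_mset.union)
  then have "v = (sum_mset A - (sum_mset U + sum_mset U)) + (sum_mset B - (sum_mset (T - A) + sum_mset (T - A)))"
    using v by simp
  then show "v \<in> ?R"
    using U unfolding signed_sums_def by blast
next
  fix v assume "v \<in> ?R"
  then obtain T U where "T \<subseteq># A" "U \<subseteq># B"
    "v = (sum_mset A - (sum_mset T + sum_mset T)) + (sum_mset B - (sum_mset U + sum_mset U))"
    unfolding signed_sums_def by blast
  then have "T + U \<subseteq># A + B"
    "v = sum_mset (A + B) - (sum_mset (T + U) + sum_mset (T + U))"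
    by (auto intro: subset_mset.add_mono)
  then show "v \<in> ?L"
    unfolding signed_sums_def by blast
qed

lemma signed_sums_single [simp]: "signed_sums {#g#} = {g, - g}"
proof -
  have "T \<subseteq># {#g#} \<longleftrightarrow> T = {#} \<or> T = {#g#}" for T
    by (cases T) auto
  then have "signed_sums {#g#} = {g - (sum_mset T + sum_mset T) | T. T = {#} \<or> T = {#g#}}"
    unfolding signed_sums_def by simp
  also have "\<dots> = {g - (sum_mset {#} + sum_mset {#}), g - (sum_mset {#g#} + sum_mset {#g#})}"
    by blast
  finally show ?thesis
    by simp
qed

lemma signed_sums_add_mset:
  "signed_sums (add_mset g S) = (+) g ` signed_sums S \<union> (+) (- g) ` signed_sums S"
proof -
  have "signed_sums (add_mset g S) = {a + b | a b. a \<in> {g, - g} \<and> b \<in> signed_sums S}"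
    using signed_sums_union[of "{#g#}" S] by simp
  then show ?thesis by blast
qed

lemma finite_signed_sums [simp]: "finite (signed_sums S)"
  by (induction S) (simp_all add: signed_sums_add_mset)

lemma signed_sums_uminus: "v \<in> signed_sums S \<Longrightarrow> - v \<in> signed_sums S"
proof (induction S arbitrary: v)
  case (add g S)
  then obtain s where "s \<in> signed_sums S" "v = g + s \<or> v = - g + s"
    by (auto simp: signed_sums_add_mset)
  then show ?case
    using add.IH[of s] by (auto simp: signed_sums_add_mset intro!: exI[of _ "- s"])
qed simp

lemma signed_choice_in_signed_sums:
  assumes "\<forall>i<length gs. \<epsilon> i \<in> {-1, 1}"
  shows "(\<Sum>i<length gs. int_mult (\<epsilon> i) (gs ! i)) \<in> signed_sums (mset gs)"
  using assms
proof (induction gs arbitrary: \<epsilon>)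
  case (Cons g gs)
  let ?s = "\<Sum>i<length gs. int_mult (\<epsilon> (Suc i)) (gs ! i)"
  have "?s \<in> signed_sums (mset gs)"
    using Cons.prems by (intro Cons.IH[of "\<lambda>i. \<epsilon> (Suc i)"]) auto
  moreover have "(\<Sum>i<length (g # gs). int_mult (\<epsilon> i) ((g # gs) ! i)) = int_mult (\<epsilon> 0) g + ?s"
    by (simp only: length_Cons sum.lessThan_Suc_shift nth_Cons_0 nth_Cons_Suc)
  moreover have "\<epsilon> 0 = 1 \<or> \<epsilon> 0 = -1"
    using Cons.prems by auto
  ultimately show ?case
    by (auto simp: signed_sums_add_mset)
qed simp

text \<open>
Signed sums do not depend on the order in which the letters are listed, so any enumeration may serve
as witness, and it can be built together with its signs letter by letter.
\<close>

lemma signed_sums_obtains_choice: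
  assumes "v \<in> signed_sums S"
  shows "\<exists>gs \<epsilon>. mset gs = S \<and> (\<forall>i<length gs. \<epsilon> i \<in> {-1, 1}) \<and>
           (\<Sum>i<length gs. int_mult (\<epsilon> i) (gs ! i)) = v"
  using assms
proof (induction S arbitrary: v)
  case (add g S)
  then obtain s c where s: "s \<in> signed_sums S" and c: "c \<in> {-1, 1}" "v = int_mult c g + s"
    by (force simp: signed_sums_add_mset)
  obtain gs \<epsilon> where gs: "mset gs = S" "\<forall>i<length gs. \<epsilon> i \<in> {-1, 1}"
    "(\<Sum>i<length gs. int_mult (\<epsilon> i) (gs ! i)) = s"
    using add.IH[OF s] by blast
  have "(\<Sum>i<length (g # gs). int_mult (case_nat c \<epsilon> i) ((g # gs) ! i)) = v"
    using gs(3) c(2)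
    by (simp only: length_Cons sum.lessThan_Suc_shift nth_Cons_0 nth_Cons_Suc nat.case)
  moreover have "\<forall>i<length (g # gs). case_nat c \<epsilon> i \<in> {-1, 1}"
    using gs(2) c(1) by (auto split: nat.split)
  moreover have "mset (g # gs) = add_mset g S"
    using gs(1) by simp
  ultimately show ?case by blast
qed simp

lemma plus_minus_zero_sum_iff: "plus_minus_zero_sum S \<longleftrightarrow> 0 \<in> signed_sums S"
proof
  assume "plus_minus_zero_sum S"
  then obtain gs \<epsilon> where "mset gs = S" "\<forall>i<length gs. \<epsilon> i \<in> {-1, 1}"
    "(\<Sum>i<length gs. int_mult (\<epsilon> i) (gs ! i)) = 0"
    unfolding plus_minus_zero_sum_def by (elim exE conjE)
  then show "0 \<in> signed_sums S"
    using signed_choice_in_signed_sums[of gs \<epsilon>] by simp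
next
  assume "0 \<in> signed_sums S"
  then show "plus_minus_zero_sum S"
    unfolding plus_minus_zero_sum_def by (rule signed_sums_obtains_choice)
qed

lemma signed_sums_subset_union:
  assumes "0 \<in> signed_sums B"
  shows "signed_sums A \<subseteq> signed_sums (A + B)"
  unfolding signed_sums_union using assms by force

lemma zero_in_signed_sums_double: "0 \<in> signed_sums (S + S)"
  unfolding signed_sums_def by (auto intro: exI[of _ S])

lemma zero_in_signed_sums_repeat_even:
  assumes "even n"
  shows "0 \<in> signed_sums (repeat_mset n S)"
  using assms zero_in_signed_sums_double[of "repeat_mset (n div 2) S"]
  by (metis even_two_times_div_two left_add_twice mult_2 repeat_mset_distrib)

lemma lift_submultiset_image:
  assumes "V \<subseteq># image_mset f S"
  obtains T where "T \<subseteq># S" "image_mset f T = V"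
proof -
  have "image_mset f S = V + (image_mset f S - V)"
    using assms by (simp add: subset_mset.add_diff_inverse)
  then obtain T U where "S = T + U" "V = image_mset f T"
    by (meson image_mset_eq_plusD)
  then show thesis
    using that[of T] by simp
qed

lemma sum_mset_double: "(\<Sum>g\<in>#T. g + g) = sum_mset T + sum_mset (T :: 'a::ab_group_add multiset)"
  by (simp add: sum_mset.distrib)

text \<open>
The right-hand side mentions \<open>S\<close> only through its sum and its multiset of doubled letters, which
lie in \<open>2G\<close>. This is how finiteness of \<open>2G\<close> can compensate for infinitely many letters.
\<close>

lemma zero_in_signed_sums_iff:
  "0 \<in> signed_sums S \<longleftrightarrow> (\<exists>T. T \<subseteq># S \<and> sum_mset S = (\<Sum>g\<in>#T. g + g))"
  unfolding signed_sums_def sum_mset_double by auto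

text \<open>
A subsequence of doubled letters with the right sum is still available after enlarging the
supply of doubled letters, even when the underlying letters have been exchanged.
\<close>

lemma zero_in_signed_sums_mono:
  fixes S S' :: "'a::ab_group_add multiset"
  assumes "0 \<in> signed_sums S"
    and "image_mset (\<lambda>g. g + g) S \<subseteq># image_mset (\<lambda>g. g + g) S'"
    and "sum_mset S = sum_mset S'"
  shows "0 \<in> signed_sums S'"
proof -
  obtain T where T: "T \<subseteq># S" "sum_mset S = (\<Sum>g\<in>#T. g + g)"
    using assms(1) unfolding zero_in_signed_sums_iff by blast
  have "image_mset (\<lambda>g. g + g) T \<subseteq># image_mset (\<lambda>g. g + g) S'"
    using T(1) assms(2) image_mset_subseteq_mono subset_mset.order_trans by blast
  then obtain T' where "T' \<subseteq># S'" "image_mset (\<lambda>g. g + g) T' = image_mset (\<lambda>g. g + g) T"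
    by (rule lift_submultiset_image)
  then show ?thesis
    using T(2) assms(3) unfolding zero_in_signed_sums_iff by metis
qed

section \<open>Doubling\<close>

lemma mem_double_UNIV: "x \<in> double (UNIV :: 'a::ab_group_add set) \<longleftrightarrow> (\<exists>h. x = h + h)"
  by (auto simp: double_def numeral_2_eq_2)

lemma double_UNIV_zero: "0 \<in> double (UNIV :: 'a::ab_group_add set)"
  unfolding mem_double_UNIV by (rule exI[of _ 0]) simp

lemma double_UNIV_diff:
  fixes a b :: "'a::ab_group_add"
  assumes "a \<in> double UNIV" "b \<in> double UNIV"
  shows "a - b \<in> double UNIV"
proof -
  obtain h k where "a = h + h" "b = k + k"
    using assms unfolding mem_double_UNIV by (elim exE)
  then have "a - b = (h - k) + (h - k)" by simp
  then show ?thesis unfolding mem_double_UNIV by blast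
qed

lemma sum_mset_in_double:
  "0 \<in> signed_sums S \<Longrightarrow> sum_mset S \<in> double (UNIV :: 'a::ab_group_add set)"
  by (auto simp: zero_in_signed_sums_iff sum_mset_double mem_double_UNIV)

section \<open>The monoid, its quotient group and its complete integral closure\<close>

lemma frag_of_mset_eq_iff [simp]: "frag_of_mset S = frag_of_mset T \<longleftrightarrow> S = T"
  using inj_frag_of_mset by (auto dest: injD)

lemma frag_of_mset_in_B_pm_iff:
  "frag_of_mset S \<in> B_pm TYPE('a::ab_group_add) \<longleftrightarrow> 0 \<in> signed_sums S"
  unfolding B_pm_def plus_minus_zero_sum_iff by auto

lemma B_pm_cases:
  assumes "x \<in> B_pm TYPE('a::ab_group_add)"
  obtains S where "x = frag_of_mset S" "0 \<in> signed_sums S"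
  using assms unfolding B_pm_def plus_minus_zero_sum_iff by auto

text \<open>
Zero-sum sequences have sum in \<open>2G\<close>, and the sum is additive. In the other direction, a
sequence \<open>S\<close> with sum \<open>2h\<close> is the quotient of \<open>S h\<^sup>2\<close> and \<open>h\<^sup>2\<close>.
\<close>

lemma frag_of_mset_in_quotient_iff:
  "frag_of_mset S \<in> quotient_group (B_pm TYPE('a::ab_group_add)) \<longleftrightarrow> sum_mset S \<in> double UNIV"
proof
  assume "frag_of_mset S \<in> quotient_group (B_pm TYPE('a))"
  then obtain A B where A: "0 \<in> signed_sums A" and B: "0 \<in> signed_sums B"
    and "frag_of_mset S = frag_of_mset A - frag_of_mset B"
    unfolding quotient_group_def by (smt (verit) B_pm_cases mem_Collect_eq)
  then have "frag_of_mset (S + B) = frag_of_mset A"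
    by (simp add: frag_of_mset_add)
  then have "sum_mset S = sum_mset A - sum_mset B"
    by auto
  then show "sum_mset S \<in> double UNIV"
    using A B by (simp add: double_UNIV_diff sum_mset_in_double)
next
  assume "sum_mset S \<in> double UNIV"
  then obtain h where h: "sum_mset S = h + h"
    unfolding mem_double_UNIV by blast
  have "0 \<in> signed_sums (S + {#h, h#})"
    unfolding zero_in_signed_sums_iff using h by (intro exI[of _ "{#h, h#}"]) simp
  moreover have "0 \<in> signed_sums {#h, h#}"
    using zero_in_signed_sums_double[of "{#h#}"] by simp
  moreover have "frag_of_mset S = frag_of_mset (S + {#h, h#}) - frag_of_mset {#h, h#}"
    by (simp only: frag_of_mset_add add_diff_cancel_right')
  ultimately show "frag_of_mset S \<in> quotient_group (B_pm TYPE('a))"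
    unfolding quotient_group_def frag_of_mset_in_B_pm_iff[symmetric] by blast
qed

lemma lookup_nat_mult: "Poly_Mapping.lookup (nat_mult n x) g = int n * Poly_Mapping.lookup x g"
  by (induction n) (simp_all add: lookup_add algebra_simps)

lemma nat_mult_frag_of_mset: "nat_mult n (frag_of_mset S) = frag_of_mset (repeat_mset n S)"
  by (induction n) (simp_all add: frag_of_mset_add)

lemma nonneg_imp_frag_of_mset:
  fixes x :: "'a \<Rightarrow>\<^sub>0 int"
  assumes "\<And>g. 0 \<le> Poly_Mapping.lookup x g"
  obtains S where "x = frag_of_mset S"
proof
  have "finite {g. 0 < nat (Poly_Mapping.lookup x g)}"
    by (rule finite_subset[OF _ finite_keys[of x]]) (auto simp: in_keys_iff)
  then have "count (Abs_multiset (\<lambda>g. nat (Poly_Mapping.lookup x g))) = (\<lambda>g. nat (Poly_Mapping.lookup x g))"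
    by (rule count_Abs_multiset)
  then show "x = frag_of_mset (Abs_multiset (\<lambda>g. nat (Poly_Mapping.lookup x g)))"
    using assms by (intro poly_mapping_eqI) (simp add: lookup_frag_of_mset)
qed

text \<open>
A negative exponent in \<open>x\<close> would eventually be negative in \<open>C x\<^sup>n\<close> too.
\<close>

lemma bounded_multiples_imp_frag_of_mset:
  fixes x :: "'a \<Rightarrow>\<^sub>0 int"
  assumes "\<And>n. 1 \<le> n \<Longrightarrow> \<exists>S. frag_of_mset C + nat_mult n x = frag_of_mset S"
  obtains S where "x = frag_of_mset S"
proof (rule nonneg_imp_frag_of_mset)
  fix g
  \<comment> \<open>This multiple outweighs the multiplicity of g in C.\<close>
  let ?n = "count C g + 1"
  obtain S where "frag_of_mset C + nat_mult ?n x = frag_of_mset S"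
    using assms[of ?n] by auto
  then have "int (count C g) + int ?n * Poly_Mapping.lookup x g = int (count S g)"
    by (metis lookup_add lookup_frag_of_mset lookup_nat_mult)
  then have "0 \<le> int (count C g) + int ?n * Poly_Mapping.lookup x g"
    by simp
  moreover have "int ?n * Poly_Mapping.lookup x g \<le> int ?n * (- 1)"
    if "Poly_Mapping.lookup x g < 0"
    using that by (intro mult_left_mono) auto
  ultimately show "0 \<le> Poly_Mapping.lookup x g"
    by (cases "Poly_Mapping.lookup x g < 0") auto
qed (use that in blast)

text \<open>
The common denominator of all powers of a sequence with sum \<open>2h\<close> is \<open>h\<^sup>2\<close>: even powers are
squares, and an odd power needs \<open>h\<^sup>2\<close> for one factor \<open>S\<close> only.
\<close>

lemma complete_integral_closure_B_pm:
  "complete_integral_closure (B_pm TYPE('a::ab_group_add)) =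
     frag_of_mset ` {S. sum_mset S \<in> double UNIV}" (is "?L = ?R")
proof (intro equalityI subsetI)
  fix x assume "x \<in> ?L"
  then obtain C where x: "x \<in> quotient_group (B_pm TYPE('a))"
    and "\<forall>n\<ge>1. frag_of_mset C + nat_mult n x \<in> B_pm TYPE('a)"
    unfolding complete_integral_closure_def by (auto elim!: B_pm_cases)
  then obtain S where "x = frag_of_mset S"
    by (metis B_pm_cases bounded_multiples_imp_frag_of_mset)
  then show "x \<in> ?R"
    using x frag_of_mset_in_quotient_iff by auto
next
  fix x assume "x \<in> ?R"
  then obtain S h where S: "x = frag_of_mset S" and h: "sum_mset S = h + h"
    by (auto simp: mem_double_UNIV)
  have sh: "0 \<in> signed_sums (S + {#h, h#})"
    unfolding zero_in_signed_sums_iff using h by (intro exI[of _ "{#h, h#}"]) simp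
  have hh: "0 \<in> signed_sums {#h, h#}"
    using zero_in_signed_sums_double[of "{#h#}"] by simp
  have "0 \<in> signed_sums ({#h, h#} + repeat_mset n S)" for n
  proof (cases "even n")
    case True
    then show ?thesis
      using signed_sums_subset_union[of "repeat_mset n S" "{#h, h#}"] hh
        zero_in_signed_sums_repeat_even by blast
  next
    case False
    then obtain m where n: "n = Suc m" and m: "even m"
      by (metis even_Suc odd_pos Suc_pred)
    have "0 \<in> signed_sums ((S + {#h, h#}) + repeat_mset m S)"
      using signed_sums_subset_union[OF zero_in_signed_sums_repeat_even[OF m]] sh by blast
    then show ?thesis
      by (simp add: n ac_simps)
  qed
  then have "\<forall>n\<ge>1. frag_of_mset {#h, h#} + nat_mult n x \<in> B_pm TYPE('a)"
    by (metis S frag_of_mset_add frag_of_mset_in_B_pm_iff nat_mult_frag_of_mset)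
  moreover have "frag_of_mset {#h, h#} \<in> B_pm TYPE('a)"
    using hh frag_of_mset_in_B_pm_iff by blast
  moreover have "x \<in> quotient_group (B_pm TYPE('a))"
    using S h frag_of_mset_in_quotient_iff mem_double_UNIV by blast
  ultimately show "x \<in> ?L"
    unfolding complete_integral_closure_def by (intro CollectI conjI bexI)
qed

section \<open>The conductor\<close>

text \<open>
The one-letter sequences \<open>d\<close> with \<open>d \<in> 2G\<close> belong to the complete integral closure and
force \<open>2G\<close> into the finite set of signed sums of any conductor element.
\<close>

lemma conductor_nonempty_iff:
  "colon (B_pm TYPE('a::ab_group_add)) (B_pm TYPE('a)) (complete_integral_closure (B_pm TYPE('a))) \<noteq> {}
     \<longleftrightarrow> finite (double (UNIV :: 'a set))" (is "?C \<noteq> {} \<longleftrightarrow> _")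
proof
  assume "?C \<noteq> {}"
  then obtain x where x: "\<And>S :: 'a multiset. sum_mset S \<in> double UNIV \<Longrightarrow> x + frag_of_mset S \<in> B_pm TYPE('a)"
    unfolding colon_def complete_integral_closure_B_pm by auto
  have "x \<in> B_pm TYPE('a)"
    using x[of "{#}"] double_UNIV_zero by simp
  then obtain T where T: "x = frag_of_mset T"
    by (rule B_pm_cases)
  have "d \<in> signed_sums T" if "d \<in> double UNIV" for d
  proof -
    have "x + frag_of_mset {#d#} \<in> B_pm TYPE('a)"
      using that by (intro x) simp
    then have "0 \<in> signed_sums (T + {#d#})"
      by (metis T frag_of_mset_add frag_of_mset_in_B_pm_iff)
    then obtain s where s: "s \<in> signed_sums T" "0 = s + d \<or> 0 = s - d"
      unfolding signed_sums_union by auto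
    then have "d = s \<or> d = - s"
      by (auto simp: eq_neg_iff_add_eq_0 add.commute)
    then show ?thesis
      using s signed_sums_uminus by blast
  qed
  then show "finite (double (UNIV :: 'a set))"
    by (meson finite_signed_sums finite_subset subsetI)
next
  assume fin: "finite (double (UNIV :: 'a set))"
  \<comment> \<open>A conductor element must compensate every possible sum d = 2h, so it contains
     one square of a half of each d.\<close>
  define half where "half = (\<lambda>d :: 'a. SOME h. d = h + h)"
  have half: "d = half d + half d" if "d \<in> double UNIV" for d
    unfolding half_def by (rule someI_ex) (use that mem_double_UNIV in blast)
  define R where "R = image_mset half (mset_set (double UNIV))"
  have "0 \<in> signed_sums ((R + R) + S)" if "sum_mset S \<in> double UNIV" for S
  proof -
    define h where "h = half (sum_mset S)"
    have "h \<in># R"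
      using fin that by (auto simp: R_def h_def)
    then obtain Q where Q: "R = add_mset h Q"
      by (metis insert_DiffM)
    have "0 \<in> signed_sums (S + {#h, h#})"
      unfolding zero_in_signed_sums_iff using half[OF that]
      by (intro exI[of _ "{#h, h#}"]) (simp add: h_def)
    then have "0 \<in> signed_sums ((S + {#h, h#}) + (Q + Q))"
      using signed_sums_subset_union[OF zero_in_signed_sums_double] by blast
    then show ?thesis
      by (simp add: Q ac_simps)
  qed
  then have "frag_of_mset (R + R) + frag_of_mset S \<in> B_pm TYPE('a)"
    if "sum_mset S \<in> double UNIV" for S
    using that by (metis frag_of_mset_add frag_of_mset_in_B_pm_iff)
  moreover have "frag_of_mset (R + R) \<in> quotient_group (B_pm TYPE('a))"
    unfolding frag_of_mset_in_quotient_iff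
    by (intro sum_mset_in_double zero_in_signed_sums_double)
  ultimately have "frag_of_mset (R + R) \<in> ?C"
    unfolding colon_def complete_integral_closure_B_pm by auto
  then show "?C \<noteq> {}"
    by blast
qed


section \<open>Mori monoids\<close>

text \<open>
An ascending chain of divisorial ideals corresponds to a descending chain of their inverses. A
strict step of the chain is witnessed by an element \<open>y n\<close> of the \<open>n\<close>-th inverse and an element
\<open>a n\<close> of the next ideal whose sum (written additively) leaves \<open>H\<close>. In the other direction, the
sequence \<open>a\<close> yields the chain of the divisorial ideals generated by its initial segments.
\<close>

lemma mori_monoid_iff:
  fixes H :: "'b::ab_group_add set"
  shows "mori_monoid H \<longleftrightarrow> is_submonoid H \<and>
    (\<forall>a y :: nat \<Rightarrow> 'b. (\<forall>n. a n \<in> H) \<and> (\<forall>n. y n \<in> quotient_group H) \<and> (\<forall>n. \<forall>m<n. y n + a m \<in> H)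
       \<longrightarrow> (\<exists>n. y n + a n \<in> H))" (is "_ \<longleftrightarrow> _ \<and> ?A")
proof (cases "is_submonoid H")
  case False
  then show ?thesis by (simp add: mori_monoid_def)
next
  case True
  then have zero: "0 \<in> H" "0 \<in> quotient_group H" and sub: "H \<subseteq> quotient_group H"
    unfolding is_submonoid_def quotient_group_def by force+
  have inv_iff: "x \<in> inverse_ideal H I \<longleftrightarrow> x \<in> quotient_group H \<and> (\<forall>y\<in>I. x + y \<in> H)" for x I
    by (simp add: inverse_ideal_def colon_def)
  have anti: "inverse_ideal H J \<subseteq> inverse_ideal H I" if "I \<subseteq> J" for I J
    using that by (auto simp: inv_iff subset_iff)
  have bidual: "I \<subseteq> inverse_ideal H (inverse_ideal H I)" if "I \<subseteq> quotient_group H" for I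
  proof
    fix x assume "x \<in> I"
    moreover have "x + y \<in> H" if "y \<in> inverse_ideal H I" for y
      using that \<open>x \<in> I\<close> unfolding inv_iff by (simp add: add.commute[of x])
    ultimately show "x \<in> inverse_ideal H (inverse_ideal H I)"
      using that inv_iff by blast
  qed
  have "mori_monoid H" if A: ?A
    unfolding mori_monoid_def
  proof (intro conjI allI impI)
    fix I :: "nat \<Rightarrow> 'b set"
    assume I: "(\<forall>n. divisorial_ideal H (I n)) \<and> (\<forall>n. I n \<subseteq> I (Suc n))"
    then have mono: "I m \<subseteq> I n" if "m \<le> n" for m n
      using that by (meson lift_Suc_mono_le)
    have IH: "I n \<subseteq> H" and v: "inverse_ideal H (inverse_ideal H (I n)) = I n" for n
      using I by (auto simp: divisorial_ideal_def v_closure_def)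
    show "\<exists>N. \<forall>n\<ge>N. I n = I N"
    proof (rule ccontr)
      assume contra: "\<not> ?thesis"
      have "\<exists>n>N. I n \<noteq> I N" for N
        using contra by (metis le_neq_implies_less)
      \<comment> \<open>Passing to a subsequence makes every step of the chain strict.\<close>
      then obtain f where f: "f n < f (Suc n)" "I (f (Suc n)) \<noteq> I (f n)" for n
        using dependent_nat_choice[of "\<lambda>_ _. True" "\<lambda>_ N n. N < n \<and> I n \<noteq> I N"] by blast
      have fmono: "f m \<le> f n" if "m \<le> n" for m n
        using f(1) that by (meson lift_Suc_mono_le less_imp_le)
      have "\<exists>y x. y \<in> inverse_ideal H (I (f n)) \<and> x \<in> I (f (Suc n)) \<and> y + x \<notin> H" for n
      proof -
        have "\<not> inverse_ideal H (I (f n)) \<subseteq> inverse_ideal H (I (f (Suc n)))"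
          using f(2)[of n] anti[OF mono[OF fmono[of n "Suc n"]]] v by (metis le_SucI order_refl subset_antisym)
        then obtain z where "z \<in> inverse_ideal H (I (f n))" "z \<notin> inverse_ideal H (I (f (Suc n)))"
          by blast
        then show ?thesis
          unfolding inv_iff by blast
      qed
      then obtain y a where ya: "\<And>n. y n \<in> inverse_ideal H (I (f n))" "\<And>n. a n \<in> I (f (Suc n))"
        "\<And>n. y n + a n \<notin> H"
        by metis
      have "a m \<in> I (f n)" if "m < n" for m n
        using ya(2)[of m] mono[OF fmono[of "Suc m" n]] that by auto
      then have "(\<forall>n. a n \<in> H) \<and> (\<forall>n. y n \<in> quotient_group H) \<and> (\<forall>n. \<forall>m<n. y n + a m \<in> H)"
        using ya(1,2) IH unfolding inv_iff by blast
      then have "\<exists>n. y n + a n \<in> H"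
        by (rule A[THEN spec, THEN spec, THEN mp])
      then show False
        using ya(3) by blast
    qed
  qed (rule True)
  moreover have ?A if mori: "mori_monoid H"
  proof (intro allI impI)
    fix a y :: "nat \<Rightarrow> 'b"
    assume ay: "(\<forall>n. a n \<in> H) \<and> (\<forall>n. y n \<in> quotient_group H) \<and> (\<forall>n. \<forall>m<n. y n + a m \<in> H)"
    define E where "E = (\<lambda>n. a ` {..<n})"
    define I where "I = (\<lambda>n. v_closure H (E n))"
    have EH: "E n \<subseteq> H" for n
      using ay by (auto simp: E_def)
    have E_I: "E n \<subseteq> I n" for n
      unfolding I_def v_closure_def by (intro bidual order_trans[OF EH sub])
    have "inverse_ideal H (E n) \<subseteq> inverse_ideal H (I n)" for n
      unfolding I_def v_closure_def by (intro bidual) (auto simp: inv_iff)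
    then have inv_I: "inverse_ideal H (I n) = inverse_ideal H (E n)" for n
      using anti[OF E_I] by blast
    have "0 \<in> inverse_ideal H (E n)" for n
      using EH zero by (auto simp: inv_iff)
    then have "I n \<subseteq> H" for n
      unfolding I_def v_closure_def by (force simp: inv_iff)
    then have "divisorial_ideal H (I n)" for n
      unfolding divisorial_ideal_def v_closure_def inv_I by (simp add: I_def v_closure_def)
    moreover have "I n \<subseteq> I (Suc n)" for n
      unfolding I_def v_closure_def by (intro anti) (auto simp: E_def)
    ultimately obtain N where N: "\<And>n. N \<le> n \<Longrightarrow> I n = I N"
      using mori unfolding mori_monoid_def by meson
    have "a N \<in> I (Suc N)"
      using E_I[of "Suc N"] by (auto simp: E_def)
    then have "a N \<in> I N"
      using N[of "Suc N"] by simp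
    moreover have "y N \<in> inverse_ideal H (I N)"
      using ay unfolding inv_I by (auto simp: inv_iff E_def)
    ultimately show "\<exists>n. y n + a n \<in> H"
      by (auto simp: inv_iff)
  qed
  ultimately show ?thesis
    using True by blast
qed

section \<open>Dickson's lemma\<close>

text \<open>
The subsequence runs through positions at which \<open>s\<close> is minimal among all later positions.
\<close>

lemma nat_sequence_mono_subsequence:
  fixes s :: "nat \<Rightarrow> nat"
  obtains r :: "nat \<Rightarrow> nat" where "strict_mono r" "mono (\<lambda>n. s (r n))"
proof -
  have "\<exists>x>N. \<forall>y>x. s x \<le> s y" for N
  proof -
    obtain x where "N < x" "\<And>y. N < y \<Longrightarrow> s x \<le> s y"
      using ex_has_least_nat[of "\<lambda>x. N < x" "Suc N" s] by auto
    then show ?thesis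
      by (meson less_trans)
  qed
  then obtain r :: "nat \<Rightarrow> nat" where "\<forall>y>r n. s (r n) \<le> s y" "r n < r (Suc n)" for n
    using dependent_nat_choice[of "\<lambda>_ x. \<forall>y>x. s x \<le> s y" "\<lambda>_ x y. x < y"] by (metis (no_types, lifting))
  then show thesis
    by (intro that[of r]) (auto simp: strict_mono_Suc_iff mono_iff_le_Suc)
qed

lemma mono_subsequence_finite_family:
  fixes F :: "('s \<Rightarrow> nat) set" and A :: "nat \<Rightarrow> 's"
  assumes "finite F"
  shows "\<exists>r :: nat \<Rightarrow> nat. strict_mono r \<and> (\<forall>f\<in>F. mono (\<lambda>n. f (A (r n))))"
  using assms
proof (induction F)
  case empty
  show ?case by (intro exI[of _ id]) (simp add: strict_mono_def)
next
  case (insert f F)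
  then obtain r :: "nat \<Rightarrow> nat" where r: "strict_mono r" "\<And>f. f \<in> F \<Longrightarrow> mono (\<lambda>n. f (A (r n)))"
    by blast
  obtain q :: "nat \<Rightarrow> nat" where q: "strict_mono q" "mono (\<lambda>n. f (A (r (q n))))"
    using nat_sequence_mono_subsequence[of "\<lambda>n. f (A (r n))"] by blast
  have "mono (\<lambda>n. g (A (r (q n))))" if "g \<in> F" for g
    using r(2)[OF that] strict_mono_mono[OF q(1)] by (auto simp: mono_def)
  moreover have "strict_mono (\<lambda>n. r (q n))"
    using r(1) q(1) by (simp add: strict_mono_def)
  ultimately show ?case
    using q(2) by (intro exI[of _ "\<lambda>n. r (q n)"]) auto
qed

text \<open>
Dickson's lemma for tuples of natural numbers, with the coordinates given as functions on
an arbitrary set, so that coordinates of different kinds can be combined.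
\<close>

lemma dickson_finite_family:
  fixes F :: "('s \<Rightarrow> nat) set"
  assumes "finite F"
  obtains m n :: nat where "m < n" "\<And>f. f \<in> F \<Longrightarrow> f (A m) \<le> f (A n)"
proof -
  obtain r :: "nat \<Rightarrow> nat" where r: "strict_mono r" "\<forall>f\<in>F. mono (\<lambda>n. f (A (r n)))"
    using mono_subsequence_finite_family[OF assms] by blast
  then show thesis
    by (intro that[of "r 0" "r 1"]) (auto simp: mono_def strict_mono_def)
qed

section \<open>The Mori property\<close>

text \<open>
Dickson's lemma provides \<open>m < n\<close> such that \<open>A m\<close> and \<open>A n\<close> have the same sum, every letter of
\<open>A 0\<close> is at least as frequent in \<open>A n\<close> as in \<open>A m\<close>, and so is every doubled letter. Replacing
the factor \<open>A m\<close> of a zero-sum sequence \<open>S = y n + a m\<close> by \<open>A n\<close> then gives a zero-sum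
sequence \<open>S'\<close>. The first coordinates ensure that \<open>S'\<close> has nonnegative exponents, since
\<open>y n + a 0\<close> is a sequence and so \<open>y n\<close> can be negative on letters of \<open>A 0\<close> only.
The others ensure that \<open>S'\<close> keeps the sum of \<open>S\<close> and loses no doubled letters.
\<close>

lemma mori_if_finite_double:
  assumes fin: "finite (double (UNIV :: 'a::ab_group_add set))"
  shows "mori_monoid (B_pm TYPE('a))"
  unfolding mori_monoid_iff
proof (intro conjI allI impI)
  fix a y :: "nat \<Rightarrow> 'a \<Rightarrow>\<^sub>0 int"
  assume ay: "(\<forall>n. a n \<in> B_pm TYPE('a)) \<and> (\<forall>n. y n \<in> quotient_group (B_pm TYPE('a))) \<and>
    (\<forall>n. \<forall>m<n. y n + a m \<in> B_pm TYPE('a))"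
  then have "\<forall>n. \<exists>S. a n = frag_of_mset S \<and> 0 \<in> signed_sums S"
    by (metis B_pm_cases)
  then obtain A where A: "\<And>n. a n = frag_of_mset (A n)" "\<And>n. 0 \<in> signed_sums (A n)"
    by metis
  let ?D = "double (UNIV :: 'a set)" and ?dbl = "\<lambda>g :: 'a. g + g"
  \<comment> \<open>The indicators of the possible sums are natural-number coordinates as well: the indicator
     of the sum of A m can only stay equal to 1, which forces equal sums.\<close>
  define F :: "('a multiset \<Rightarrow> nat) set" where
    "F = (\<lambda>g S. count S g) ` set_mset (A 0) \<union> (\<lambda>d S. count (image_mset ?dbl S) d) ` ?D
       \<union> (\<lambda>d S. of_bool (sum_mset S = d)) ` ?D"
  have "finite F"
    using fin by (simp add: F_def)
  then obtain m n where "m < n" and le: "\<And>f. f \<in> F \<Longrightarrow> f (A m) \<le> f (A n)"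
    using dickson_finite_family[of F A] by blast
  have count_le: "count (A m) g \<le> count (A n) g" if "g \<in># A 0" for g
    using le[of "\<lambda>S. count S g"] that by (auto simp: F_def)
  have "count (image_mset ?dbl (A m)) d \<le> count (image_mset ?dbl (A n)) d" for d
  proof (cases "d \<in> ?D")
    case True
    then show ?thesis
      using le[of "\<lambda>S. count (image_mset ?dbl S) d"] by (auto simp: F_def)
  next
    case False
    then have "count (image_mset ?dbl (A m)) d = 0"
      unfolding count_eq_zero_iff by (auto simp: mem_double_UNIV)
    then show ?thesis
      by simp
  qed
  then have image_le: "image_mset ?dbl (A m) \<subseteq># image_mset ?dbl (A n)"
    by (simp add: subseteq_mset_def)
  have "of_bool (sum_mset (A m) = sum_mset (A m)) \<le> (of_bool (sum_mset (A n) = sum_mset (A m)) :: nat)"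
    using sum_mset_in_double[OF A(2)[of m]]
    by (intro le[of "\<lambda>S. of_bool (sum_mset S = sum_mset (A m))"]) (auto simp: F_def)
  then have sum_eq: "sum_mset (A n) = sum_mset (A m)"
    by (cases "sum_mset (A n) = sum_mset (A m)") simp_all
  have "y n + a m \<in> B_pm TYPE('a)" "y n + a 0 \<in> B_pm TYPE('a)"
    using ay \<open>m < n\<close> by auto
  then obtain S S0 where S: "y n + a m = frag_of_mset S" "0 \<in> signed_sums S"
    and S0: "y n + a 0 = frag_of_mset S0"
    by (metis B_pm_cases)
  have "frag_of_mset (S + A 0) = frag_of_mset (S0 + A m)"
    unfolding frag_of_mset_add S(1)[symmetric] S0[symmetric] A(1)[symmetric] by (simp add: ac_simps)
  then have S_A0: "S + A 0 = S0 + A m"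
    by simp
  have "count (A m) g \<le> count (S + A n) g" for g
  proof (cases "g \<in># A 0")
    case True
    then show ?thesis
      using count_le[of g] by simp
  next
    case False
    then have "count S g = count S0 g + count (A m) g"
      using arg_cong[OF S_A0, of "\<lambda>M. count M g"] by (simp add: not_in_iff)
    then show ?thesis
      by simp
  qed
  then have "A m \<subseteq># S + A n"
    by (simp add: subseteq_mset_def)
  then obtain S' where S': "S + A n = A m + S'"
    by (metis subset_mset.add_diff_inverse)
  have "sum_mset S + sum_mset (A n) = sum_mset (A m) + sum_mset S'"
    using S' by (metis sum_mset.union)
  then have "sum_mset S = sum_mset S'"
    using sum_eq by simp
  moreover have "image_mset ?dbl S \<subseteq># image_mset ?dbl S'"
  proof -
    have eq: "image_mset ?dbl S + image_mset ?dbl (A n) = image_mset ?dbl (A m) + image_mset ?dbl S'"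
      using S' by (metis image_mset_union)
    obtain Q where "image_mset ?dbl (A n) = image_mset ?dbl (A m) + Q"
      using image_le by (metis subset_mset.add_diff_inverse)
    then have "image_mset ?dbl S' = image_mset ?dbl S + Q"
      using eq by (simp add: union_assoc add.left_commute)
    then show ?thesis
      by simp
  qed
  ultimately have "0 \<in> signed_sums S'"
    using zero_in_signed_sums_mono[OF S(2)] by blast
  moreover have "y n + a n = frag_of_mset S'"
  proof -
    have "frag_of_mset S + a n = a m + frag_of_mset S'"
      unfolding A(1) frag_of_mset_add[symmetric] S' ..
    then have "a m + (y n + a n) = a m + frag_of_mset S'"
      unfolding S(1)[symmetric] by (simp add: ac_simps)
    then show ?thesis
      by simp
  qed
  ultimately show "\<exists>n. y n + a n \<in> B_pm TYPE('a)"
    using frag_of_mset_in_B_pm_iff by metis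
qed (rule is_submonoid_B_pm)


lemma signed_sums_pair: "signed_sums {#k, k#} = {k + k, 0, - (k + k)}"
  by (auto simp: signed_sums_add_mset)

text \<open>
With \<open>x n\<close> for the letters chosen, \<open>Y n\<close> is \<open>b\<close> times the squares of \<open>x 0, \<dots>, x (n - 1)\<close>. Since a
square \<open>x\<^sup>2\<close> has signed sums \<open>0\<close> and \<open>\<plusminus>2x\<close>, the signed sums of \<open>Y n\<close> contain \<open>b + 2 x m\<close> for all
\<open>m < n\<close>, which is a signed sum of \<open>A m = (e + x m)\<^sup>2\<close>. So \<open>Y n + A m\<close> is zero-sum for \<open>m < n\<close>. The
letter \<open>x n\<close> is chosen such that \<open>2 x n\<close> is not a signed sum of \<open>Y n\<close>, which keeps \<open>0\<close> out of the signed
sums of \<open>Y (n + 1)\<close>, and such that \<open>b + 2 x n\<close> is not a signed sum of \<open>Y n\<close>, which prevents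
\<open>Y n + A n\<close> from being zero-sum.
\<close>

lemma finite_double_if_mori:
  assumes mori: "mori_monoid (B_pm TYPE('a::ab_group_add))"
  shows "finite (double (UNIV :: 'a set))"
proof (rule ccontr)
  assume inf: "infinite (double (UNIV :: 'a set))"
  then have "infinite (double (UNIV :: 'a set) - {0})"
    by simp
  then have "\<exists>b. b \<in> double (UNIV :: 'a set) - {0}"
    unfolding ex_in_conv by (rule infinite_imp_nonempty)
  then obtain b where "b \<in> double (UNIV :: 'a set)" "b \<noteq> 0"
    by (elim exE DiffE) simp
  then obtain e where b: "b \<noteq> 0" "b = e + e"
    unfolding mem_double_UNIV by (elim exE)
  \<comment> \<open>The values of twice the next letter that would spoil one of the two requirements.\<close>
  define Bad where "Bad = (\<lambda>Y. signed_sums Y \<union> (\<lambda>s. s - b) ` signed_sums Y)"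
  have "\<exists>k. k + k \<notin> Bad Y" for Y
  proof -
    have "finite (Bad Y)"
      by (simp add: Bad_def)
    then have "\<not> double UNIV \<subseteq> Bad Y"
      using inf finite_subset by blast
    then show ?thesis
      by (auto simp: mem_double_UNIV)
  qed
  then obtain k where k: "\<And>Y. k Y + k Y \<notin> Bad Y"
    by metis
  define Y where "Y = rec_nat {#b#} (\<lambda>_ Y. Y + {#k Y, k Y#})"
  have Y0: "Y 0 = {#b#}" and Y_Suc: "\<And>n. Y (Suc n) = Y n + {#k (Y n), k (Y n)#}"
    by (simp_all add: Y_def)
  define x where "x = (\<lambda>n. k (Y n))"
  define A where "A = (\<lambda>n. {#e + x n, e + x n#})"
  have x: "x n + x n \<notin> signed_sums (Y n)" "b + (x n + x n) \<notin> signed_sums (Y n)" for n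
    using k[of "Y n"] by (auto simp: Bad_def x_def image_iff algebra_simps)
  have sums_Suc: "signed_sums (Y (Suc n)) =
    {s + t | s t. s \<in> signed_sums (Y n) \<and> t \<in> {x n + x n, 0, - (x n + x n)}}" for n
    unfolding Y_Suc signed_sums_union signed_sums_pair x_def ..
  have sums_mono: "signed_sums (Y n) \<subseteq> signed_sums (Y (Suc n))" for n
    unfolding Y_Suc by (rule signed_sums_subset_union) (simp add: signed_sums_pair)
  have neg: "s = d \<or> s = - d" if "s + t = 0" "t \<in> {d, - d}" for s t d :: 'a
  proof -
    have "s = - t"
      using that(1) by (simp only: eq_neg_iff_add_eq_0)
    then show ?thesis
      using that(2) by auto
  qed
  have zero_notin: "0 \<notin> signed_sums (Y n)" for n
  proof (induction n)
    case 0
    then show ?case using b(1) by (simp add: Y0)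
  next
    case (Suc n)
    show ?case
    proof
      assume "0 \<in> signed_sums (Y (Suc n))"
      then obtain s t where s: "s \<in> signed_sums (Y n)" "s + t = 0" and t: "t \<in> {x n + x n, 0, - (x n + x n)}"
        unfolding sums_Suc by force
      have "t \<noteq> 0"
        using s Suc.IH by auto
      then have "s = x n + x n \<or> s = - (x n + x n)"
        using t by (intro neg[OF s(2)]) auto
      then show False
        using s(1) x(1)[of n] signed_sums_uminus[OF s(1)] by auto
    qed
  qed
  have b_in: "b \<in> signed_sums (Y n)" for n
    using sums_mono by (induction n) (auto simp: Y0)
  have hit: "b + (x m + x m) \<in> signed_sums (Y n)" if "m < n" for m n
    using that
  proof (induction n)
    case (Suc n)
    show ?case
    proof (cases "m = n")
      case True
      then show ?thesis
        unfolding sums_Suc using b_in[of n] by blast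
    next
      case False
      then show ?thesis
        using Suc sums_mono[of n] by auto
    qed
  qed simp
  have sums_A: "signed_sums (A n) = {b + (x n + x n), 0, - (b + (x n + x n))}" for n
    unfolding A_def signed_sums_pair b(2) by (simp add: algebra_simps)
  have "0 \<in> signed_sums (Y n + A m)" if "m < n" for m n
    unfolding signed_sums_union sums_A using hit[OF that] by force
  moreover have "0 \<notin> signed_sums (Y n + A n)" for n
  proof
    assume "0 \<in> signed_sums (Y n + A n)"
    then obtain s t where s: "s \<in> signed_sums (Y n)" "s + t = 0"
      and t: "t \<in> {b + (x n + x n), 0, - (b + (x n + x n))}"
      unfolding signed_sums_union sums_A by force
    have "t \<noteq> 0"
      using s zero_notin[of n] by auto
    then have "s = b + (x n + x n) \<or> s = - (b + (x n + x n))"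
      using t by (intro neg[OF s(2)]) auto
    then show False
      using s(1) x(2)[of n] signed_sums_uminus[OF s(1)] by (metis minus_minus)
  qed
  moreover have "sum_mset (Y n) \<in> double UNIV" for n
  proof (induction n)
    case 0
    then show ?case using b by (auto simp: Y0 mem_double_UNIV)
  next
    case (Suc n)
    then obtain h where "sum_mset (Y n) = h + h"
      unfolding mem_double_UNIV by (elim exE)
    then have "sum_mset (Y (Suc n)) = (h + x n) + (h + x n)"
      by (simp add: Y_Suc x_def algebra_simps)
    then show ?case
      unfolding mem_double_UNIV by (rule exI)
  qed
  moreover have "0 \<in> signed_sums (A n)" for n
    by (simp add: sums_A)
  ultimately have seqs: "(\<forall>n. frag_of_mset (A n) \<in> B_pm TYPE('a)) \<and>
      (\<forall>n. frag_of_mset (Y n) \<in> quotient_group (B_pm TYPE('a))) \<and>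
      (\<forall>n. \<forall>m<n. frag_of_mset (Y n) + frag_of_mset (A m) \<in> B_pm TYPE('a))"
    and miss: "\<forall>n. frag_of_mset (Y n) + frag_of_mset (A n) \<notin> B_pm TYPE('a)"
    by (simp_all add: frag_of_mset_in_B_pm_iff frag_of_mset_in_quotient_iff flip: frag_of_mset_add)
  have "\<exists>n. frag_of_mset (Y n) + frag_of_mset (A n) \<in> B_pm TYPE('a)"
    by (rule mori[unfolded mori_monoid_iff, THEN conjunct2, THEN spec, THEN spec, THEN mp, OF seqs])
  then show False
    using miss by blast
qed

section \<open>Splitting off an elementary 2-group\<close>

text \<open>
The coset of \<open>x\<close> is its own inverse modulo \<open>K\<close>, so one coset suffices. It is used both to enlarge
finite subgroups and to contradict the maximality of an elementary 2-subgroup.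
\<close>

lemma is_subgroup_adjoin:
  fixes x :: "'a::ab_group_add"
  assumes K: "is_subgroup K" and x: "x + x \<in> K"
  shows "is_subgroup (K \<union> (+) x ` K)"
proof -
  have K0: "0 \<in> K" and add: "\<And>a b. a \<in> K \<Longrightarrow> b \<in> K \<Longrightarrow> a + b \<in> K" and neg: "\<And>a. a \<in> K \<Longrightarrow> - a \<in> K"
    using K unfolding is_subgroup_def by auto
  have mixed: "a + (x + b) \<in> (+) x ` K" "(x + a) + b \<in> (+) x ` K" if "a \<in> K" "b \<in> K" for a b
    using add[OF that] by (auto simp: image_iff algebra_simps intro!: bexI[of _ "a + b"])
  have both: "(x + a) + (x + b) \<in> K" if "a \<in> K" "b \<in> K" for a b
    using add[OF x add[OF that]] by (simp add: ac_simps)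
  have minus: "- (x + a) \<in> (+) x ` K" if "a \<in> K" for a
    using add[OF neg[OF x] neg[OF that]]
    by (intro image_eqI[of _ _ "- (x + x) + - a"]) simp_all
  show ?thesis
    unfolding is_subgroup_def
  proof (intro conjI ballI)
    fix a b assume "a \<in> K \<union> (+) x ` K" "b \<in> K \<union> (+) x ` K"
    then show "a + b \<in> K \<union> (+) x ` K"
      by (elim UnE imageE; simp only: Un_iff add mixed both simp_thms)
  next
    fix a assume "a \<in> K \<union> (+) x ` K"
    then show "- a \<in> K \<union> (+) x ` K"
      by (elim UnE imageE; simp only: Un_iff neg minus simp_thms)
  qed (simp add: K0)
qed

text \<open>
Starting from the subgroup \<open>2G\<close>, each adjoined element at most doubles the size of the subgroup.
\<close>

lemma finite_subgroup_containing:
  fixes F :: "'a::ab_group_add set"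
  assumes "finite (double (UNIV :: 'a set))" "finite F"
  shows "\<exists>K. is_subgroup K \<and> finite K \<and> double UNIV \<subseteq> K \<and> F \<subseteq> K"
  using assms(2)
proof (induction F)
  case empty
  have "- a \<in> double UNIV" if "a \<in> double UNIV" for a :: 'a
    using double_UNIV_diff[OF double_UNIV_zero that] by simp
  moreover from this have "a + b \<in> double UNIV" if "a \<in> double UNIV" "b \<in> double UNIV" for a b :: 'a
    using double_UNIV_diff[OF that(1), of "- b"] that(2) by simp
  ultimately show ?case
    using assms(1) double_UNIV_zero
    by (intro exI[of _ "double UNIV"]) (simp add: is_subgroup_def)
next
  case (insert x F)
  then obtain K where K: "is_subgroup K" "finite K" "double UNIV \<subseteq> K" "F \<subseteq> K"
    by blast
  have "x + x \<in> K"
    using K(3) mem_double_UNIV by blast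
  then have "is_subgroup (K \<union> (+) x ` K)"
    by (rule is_subgroup_adjoin[OF K(1)])
  moreover have "x \<in> K \<union> (+) x ` K"
    using K(1) by (auto simp: is_subgroup_def image_iff intro!: bexI[of _ 0])
  ultimately show ?case
    using K by (intro exI[of _ "K \<union> (+) x ` K"]) auto
qed

lemma elementary_2_group_iff:
  "0 \<in> A \<Longrightarrow> elementary_2_group A \<longleftrightarrow> (\<forall>a\<in>A. a + a = 0)"
  unfolding elementary_2_group_def double_def by (force simp: numeral_2_eq_2)

text \<open>
By assumption each \<open>g\<close> differs from an element of \<open>K\<close> by some \<open>t\<close> with \<open>2t = 0\<close>. Among the
subgroups of such elements \<open>t\<close> that meet \<open>K\<close> trivially there is a maximal one \<open>M\<close> by Zorn's lemma. If some
\<open>t\<close> with \<open>2t = 0\<close> were outside \<open>M + K\<close>, then adjoining it to \<open>M\<close> would still give such a subgroup.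
\<close>

lemma complement_with_elementary_2_group:
  fixes K :: "'a::ab_group_add set"
  assumes K: "is_subgroup K" and G: "\<And>g. \<exists>h\<in>K. g + g = h + h"
  obtains M where "direct_sum UNIV M K" "elementary_2_group M"
proof -
  have K0: "0 \<in> K" and K_add: "\<And>a b. a \<in> K \<Longrightarrow> b \<in> K \<Longrightarrow> a + b \<in> K"
    using K unfolding is_subgroup_def by auto
  define \<A> where "\<A> = {A. is_subgroup A \<and> (\<forall>a\<in>A. a + a = 0) \<and> A \<inter> K = {0}}"
  have "\<exists>M\<in>\<A>. \<forall>X\<in>\<A>. M \<subseteq> X \<longrightarrow> X = M"
  proof (rule subset_Zorn_nonempty)
    have "{0} \<in> \<A>"
      using K0 by (simp add: \<A>_def is_subgroup_def)
    then show "\<A> \<noteq> {}" by blast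
  next
    fix \<C> assume "\<C> \<noteq> {}" and chain: "subset.chain \<A> \<C>"
    then have C: "\<And>A. A \<in> \<C> \<Longrightarrow> A \<in> \<A>" and total: "\<And>A B. A \<in> \<C> \<Longrightarrow> B \<in> \<C> \<Longrightarrow> A \<subseteq> B \<or> B \<subseteq> A"
      unfolding subset.chain_def by auto
    have "a + b \<in> \<Union>\<C>" if ab: "a \<in> \<Union>\<C>" "b \<in> \<Union>\<C>" for a b
    proof -
      obtain A B where "A \<in> \<C>" "a \<in> A" "B \<in> \<C>" "b \<in> B"
        using ab by blast
      then obtain D where D: "D \<in> \<C>" "a \<in> D" "b \<in> D"
        using total by blast
      then have "a + b \<in> D"
        using C[of D] unfolding \<A>_def is_subgroup_def by simp
      then show ?thesis
        using D(1) by blast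
    qed
    moreover have "0 \<in> \<Union>\<C>"
      using \<open>\<C> \<noteq> {}\<close> C by (force simp: \<A>_def is_subgroup_def)
    moreover have "- a \<in> \<Union>\<C> \<and> a + a = 0 \<and> (a \<in> K \<longrightarrow> a = 0)" if "a \<in> \<Union>\<C>" for a
    proof -
      obtain A where "A \<in> \<C>" "a \<in> A" "A \<in> \<A>"
        using \<open>a \<in> \<Union>\<C>\<close> C by blast
      then show ?thesis
        unfolding \<A>_def is_subgroup_def by auto
    qed
    ultimately show "\<Union>\<C> \<in> \<A>"
      unfolding \<A>_def is_subgroup_def using K0 by blast
  qed
  then obtain M where "M \<in> \<A>" and max: "\<And>X. X \<in> \<A> \<Longrightarrow> M \<subseteq> X \<Longrightarrow> X = M"
    by blast
  then have M: "is_subgroup M" and M_two: "\<And>a. a \<in> M \<Longrightarrow> a + a = 0" and MK: "M \<inter> K = {0}"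
    unfolding \<A>_def by auto
  have M0: "0 \<in> M" and M_neg: "\<And>a. a \<in> M \<Longrightarrow> - a \<in> M"
    using M unfolding is_subgroup_def by auto
  have two_torsion: "\<exists>m\<in>M. \<exists>h\<in>K. t = m + h" if t: "t + t = 0" for t
  proof (rule ccontr)
    assume no: "\<not> ?thesis"
    let ?M = "M \<union> (+) t ` M"
    have "is_subgroup ?M"
      by (rule is_subgroup_adjoin[OF M]) (simp add: t M0)
    moreover have "(t + m) + (t + m) = 0" if "m \<in> M" for m
    proof -
      have "(t + m) + (t + m) = (t + t) + (m + m)"
        by (simp add: algebra_simps)
      then show ?thesis
        using t M_two[OF that] by simp
    qed
    moreover have "t + m \<notin> K" if "m \<in> M" for m
    proof
      assume "t + m \<in> K"
      moreover have "t = - m + (t + m)" by simp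
      ultimately show False
        using no M_neg[OF that] by blast
    qed
    ultimately have "?M \<in> \<A>"
      using M_two MK unfolding \<A>_def by auto
    then have "?M = M"
      by (rule max) blast
    then have "t + 0 \<in> M"
      using M0 by blast
    then show False
      using no K0 by force
  qed
  have "\<exists>a b. g = a + b \<and> a \<in> M \<and> b \<in> K" for g
  proof -
    obtain h where h: "h \<in> K" "g + g = h + h"
      using G by blast
    have "(g - h) + (g - h) = (g + g) - (h + h)"
      by (simp add: algebra_simps)
    then obtain m h' where m: "m \<in> M" "h' \<in> K" "g - h = m + h'"
      using two_torsion[of "g - h"] h(2) by auto
    have "g = m + (h' + h)"
      using m(3) by (simp add: algebra_simps)
    then show ?thesis
      using m K_add h(1) by blast
  qed
  then have "direct_sum UNIV M K"
    unfolding direct_sum_def using M K MK by auto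
  moreover have "elementary_2_group M"
    using M0 M_two elementary_2_group_iff by blast
  ultimately show thesis
    by (rule that)
qed

text \<open>
The finite summand is a finite subgroup containing a half of each element of \<open>2G\<close>. Conversely,
doubling annihilates the elementary 2-group, so \<open>2G\<close> consists of doubled elements of the finite summand.
\<close>

lemma finite_double_iff_direct_sum:
  "finite (double (UNIV :: 'a::ab_group_add set)) \<longleftrightarrow>
     (\<exists>G1 G2 :: 'a set. direct_sum UNIV G1 G2 \<and> elementary_2_group G1 \<and> finite G2)"
proof
  assume fin: "finite (double (UNIV :: 'a set))"
  have "double UNIV \<subseteq> range (\<lambda>h :: 'a. h + h)"
    by (auto simp: mem_double_UNIV)
  then have "\<exists>F\<subseteq>UNIV. finite F \<and> double UNIV = (\<lambda>h :: 'a. h + h) ` F"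
    by (rule finite_subset_image[OF fin])
  then obtain F where F: "finite F" "double UNIV = (\<lambda>h :: 'a. h + h) ` F"
    by (elim exE conjE)
  obtain K where K: "is_subgroup K" "finite K" "F \<subseteq> K"
    using finite_subgroup_containing[OF fin F(1)] by blast
  have "\<exists>h\<in>K. g + g = h + h" for g
  proof -
    have "g + g \<in> (\<lambda>h. h + h) ` F"
      unfolding F(2)[symmetric] mem_double_UNIV by blast
    then show ?thesis
      using K(3) by blast
  qed
  then show "\<exists>G1 G2 :: 'a set. direct_sum UNIV G1 G2 \<and> elementary_2_group G1 \<and> finite G2"
    using complement_with_elementary_2_group[OF K(1)] K(2) by metis
next
  assume "\<exists>G1 G2 :: 'a set. direct_sum UNIV G1 G2 \<and> elementary_2_group G1 \<and> finite G2"
  then obtain G1 G2 :: "'a set" where G: "direct_sum UNIV G1 G2" "elementary_2_group G1" "finite G2"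
    by blast
  have two: "\<And>a. a \<in> G1 \<Longrightarrow> a + a = 0"
    using G(1,2) elementary_2_group_iff unfolding direct_sum_def is_subgroup_def by blast
  have "h + h \<in> (\<lambda>b. b + b) ` G2" for h
  proof -
    have "h \<in> {a + b | a b. a \<in> G1 \<and> b \<in> G2}"
      using G(1) unfolding direct_sum_def by (metis UNIV_I)
    then obtain a b where "a \<in> G1" "b \<in> G2" "h = a + b"
      by blast
    then have "h + h = (a + a) + (b + b)"
      by (simp add: algebra_simps)
    then show ?thesis
      using two \<open>a \<in> G1\<close> \<open>b \<in> G2\<close> by simp
  qed
  then have "double UNIV \<subseteq> (\<lambda>b. b + b) ` G2"
    by (auto simp: mem_double_UNIV)
  then show "finite (double (UNIV :: 'a set))"
    using G(3) finite_subset by blast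
qed

section \<open>Seminormality\<close>

lemma nat_mult_add: "nat_mult (m + n) x = nat_mult m x + nat_mult n x"
  by (induction m) (simp_all add: add.assoc)

lemma nat_mult_4: "nat_mult 4 g = (g + g) + (g + g)"
  by (simp add: eval_nat_numeral add.assoc)

lemma nat_mult_dvd_zero: "m dvd n \<Longrightarrow> nat_mult m g = 0 \<Longrightarrow> nat_mult n g = 0"
proof -
  assume "m dvd n" and m: "nat_mult m g = 0"
  have "nat_mult (m * k) g = 0" for k
    by (induction k) (simp_all add: nat_mult_add m)
  then show ?thesis
    using \<open>m dvd n\<close> by (auto elim: dvdE)
qed

lemma enat_dvd_4_iff: "enat n dvd 4 \<longleftrightarrow> n dvd 4"
proof
  assume "enat n dvd 4"
  then obtain k :: enat where k: "enat 4 = enat n * k"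
    by (auto elim!: dvdE simp: numeral_eq_enat)
  then obtain j where "k = enat j"
    by (cases k) (auto simp: times_enat_def zero_enat_def split: if_splits)
  then show "n dvd 4"
    using k by (auto intro: dvdI)
next
  assume "n dvd 4"
  then obtain j where "4 = n * j" by (elim dvdE)
  then have "(4 :: enat) = enat n * enat j"
    by (simp add: numeral_eq_enat)
  then show "enat n dvd 4" by (rule dvdI)
qed

text \<open>
The least positive annihilator \<open>L\<close> is at most \<open>4\<close> if \<open>4\<close> annihilates. The value \<open>3\<close> is impossible,
because then \<open>1 = 4 - 3\<close> would annihilate as well.
\<close>

lemma exponent_dvd_4_iff:
  "exponent (UNIV :: 'a::ab_group_add set) dvd 4 \<longleftrightarrow> (\<forall>g :: 'a. nat_mult 4 g = 0)"
proof -
  let ?P = "\<lambda>n. n > 0 \<and> (\<forall>g :: 'a. nat_mult n g = 0)"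
  show ?thesis
  proof
    assume dvd: "exponent (UNIV :: 'a set) dvd 4"
    show "\<forall>g :: 'a. nat_mult 4 g = 0"
    proof (cases "\<exists>n. ?P n")
      case True
      then have "exponent (UNIV :: 'a set) = enat (LEAST n. ?P n)"
        by (simp add: exponent_def)
      then have "(LEAST n. ?P n) dvd 4"
        using dvd by (simp add: enat_dvd_4_iff)
      moreover have "?P (LEAST n. ?P n)"
        using True by (rule LeastI_ex)
      ultimately show ?thesis
        using nat_mult_dvd_zero by blast
    next
      case False
      then have "exponent (UNIV :: 'a set) = \<infinity>"
        by (auto simp: exponent_def)
      then show ?thesis
        using dvd not_infinity_dvd_4 by simp
    qed
  next
    assume four: "\<forall>g :: 'a. nat_mult 4 g = 0"
    define L where "L = (LEAST n. ?P n)"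
    have P4: "?P 4"
      using four by simp
    then have PL: "?P L"
      unfolding L_def by (rule LeastI)
    have least: "L \<le> n" if "?P n" for n
      unfolding L_def using that by (rule Least_le)
    have "L \<noteq> 3"
    proof
      assume "L = 3"
      then have "nat_mult 3 g = 0" for g :: 'a
        using PL by simp
      then have "nat_mult 1 g = 0" for g :: 'a
        using four nat_mult_add[of 1 3 g] by simp
      then show False
        using least[of 1] \<open>L = 3\<close> by simp
    qed
    moreover have "L \<le> 4" "L > 0"
      using least[OF P4] PL by auto
    ultimately have "L = 1 \<or> L = 2 \<or> L = 4"
      by arith
    then have "L dvd 4"
      by auto
    moreover have "exponent (UNIV :: 'a set) = enat L"
    proof -
      have "\<exists>n. ?P n"
        using P4 by (rule exI)
      then show ?thesis
        by (simp add: exponent_def L_def)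
    qed
    ultimately show "exponent (UNIV :: 'a set) dvd 4"
      by (simp add: enat_dvd_4_iff)
  qed
qed

text \<open>
\<open>P\<close> collects the elements of odd multiplicity, once each.
\<close>

lemma multiset_parity_decomposition: "\<exists>P U. T = P + (U + U) \<and> (\<forall>g. count P g \<le> 1)"
proof (induction T)
  case empty
  show ?case by (intro exI[of _ "{#}"]) simp
next
  case (add x T)
  then obtain P U where PU: "T = P + (U + U)" "\<forall>g. count P g \<le> 1"
    by blast
  show ?case
  proof (cases "x \<in># P")
    case True
    then obtain Q where Q: "P = add_mset x Q"
      by (metis insert_DiffM)
    then have "add_mset x T = Q + (add_mset x U + add_mset x U)"
      using PU(1) by simp
    moreover have "\<forall>g. count Q g \<le> 1"
      using PU(2) Q by (metis count_add_mset le_SucI Suc_le_mono order_trans le_add2 plus_1_eq_Suc)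
    ultimately show ?thesis by blast
  next
    case False
    then have "\<forall>g. count (add_mset x P) g \<le> 1"
      using PU(2) by (simp add: not_in_iff)
    moreover have "add_mset x T = add_mset x P + (U + U)"
      using PU(1) by simp
    ultimately show ?thesis by blast
  qed
qed

lemma sum_mset_repeat: "sum_mset (repeat_mset n S) = nat_mult n (sum_mset S)"
  by (induction n) simp_all

text \<open>
Both sides of the equation \<open>m \<sigma>(S) = 2 \<sigma>(T)\<close>, with \<open>T\<close> a subsequence of \<open>S\<^sup>m\<close>, can be
reduced: \<open>m \<sigma>(S) = \<sigma>(S)\<close> because \<open>\<sigma>(S) \<in> 2G\<close> has order at most two and \<open>m\<close> is odd, and on the right each
pair of equal letters \<open>g\<close> contributes \<open>4g = 0\<close>. The letters of odd multiplicity in \<open>T\<close>, taken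
once each, form a subsequence of \<open>S\<close>.
\<close>

lemma zero_in_signed_sums_of_odd_power:
  fixes S :: "'a::ab_group_add multiset"
  assumes four: "\<And>g :: 'a. nat_mult 4 g = 0"
    and S: "sum_mset S \<in> double UNIV"
    and m: "odd m" "0 \<in> signed_sums (repeat_mset m S)"
  shows "0 \<in> signed_sums S"
proof -
  obtain T where T: "T \<subseteq># repeat_mset m S" "sum_mset (repeat_mset m S) = (\<Sum>g\<in>#T. g + g)"
    using m(2) unfolding zero_in_signed_sums_iff by blast
  obtain P U where PU: "T = P + (U + U)" and P: "\<And>g. count P g \<le> 1"
    using multiset_parity_decomposition by blast
  have "P \<subseteq># S"
    unfolding subseteq_mset_def
  proof
    fix g
    have "count P g \<le> m * count S g"
      using T(1) PU by (metis count_repeat_mset mset_subset_eq_add_left mset_subset_eq_count subset_mset.order_trans)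
    then show "count P g \<le> count S g"
      using P[of g] by (cases "count S g") auto
  qed
  moreover have "(\<Sum>g\<in>#T. g + g) = (\<Sum>g\<in>#P. g + g)"
    using four[of "sum_mset U"] by (simp add: PU sum_mset_double nat_mult_4)
  moreover have "sum_mset (repeat_mset m S) = sum_mset S"
  proof -
    obtain h where h: "sum_mset S = h + h"
      using S unfolding mem_double_UNIV by (elim exE)
    obtain j where j: "m = Suc (2 * j)"
      using m(1) by (elim oddE) simp
    have "nat_mult 2 (sum_mset S) = 0"
      using four[of h] by (simp add: h nat_mult_4 numeral_2_eq_2)
    then have "nat_mult (2 * j) (sum_mset S) = 0"
      by (rule nat_mult_dvd_zero[rotated]) simp
    then show ?thesis
      by (simp add: sum_mset_repeat j)
  qed
  ultimately show ?thesis
    using T(2) unfolding zero_in_signed_sums_iff by metis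
qed

lemma subset_seminormal_closure:
  assumes "is_submonoid H"
  shows "H \<subseteq> seminormal_closure H"
proof
  fix x assume x: "x \<in> H"
  have "nat_mult n x \<in> H" for n
    using assms x by (induction n) (auto simp: is_submonoid_def)
  moreover have "x = x - 0" "0 \<in> H"
    using assms by (auto simp: is_submonoid_def)
  ultimately show "x \<in> seminormal_closure H"
    using x unfolding seminormal_closure_def quotient_group_def by blast
qed

lemma seminormal_if_four_annihilates:
  assumes four: "\<And>g :: 'a::ab_group_add. nat_mult 4 g = 0"
  shows "seminormal (B_pm TYPE('a))"
  unfolding seminormal_def
proof (intro equalityI subsetI)
  fix x assume "x \<in> seminormal_closure (B_pm TYPE('a))"
  then obtain n where x: "x \<in> quotient_group (B_pm TYPE('a))" and n: "n \<ge> 1"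
    and mult: "\<And>m. m \<ge> n \<Longrightarrow> nat_mult m x \<in> B_pm TYPE('a)"
    unfolding seminormal_closure_def by blast
  have "0 \<le> Poly_Mapping.lookup x g" for g
  proof -
    obtain R where "nat_mult n x = frag_of_mset R"
      using mult[of n] by (auto elim: B_pm_cases)
    then have "int n * Poly_Mapping.lookup x g = int (count R g)"
      by (metis lookup_frag_of_mset lookup_nat_mult)
    then have "0 \<le> int n * Poly_Mapping.lookup x g"
      by simp
    then show ?thesis
      using n by (simp add: zero_le_mult_iff)
  qed
  then obtain S where S: "x = frag_of_mset S"
    by (rule nonneg_imp_frag_of_mset)
  have "nat_mult (2 * n + 1) x \<in> B_pm TYPE('a)"
    by (rule mult) simp
  then have "0 \<in> signed_sums (repeat_mset (2 * n + 1) S)"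
    by (simp only: S nat_mult_frag_of_mset frag_of_mset_in_B_pm_iff)
  then have "0 \<in> signed_sums S"
    using x by (intro zero_in_signed_sums_of_odd_power[OF four, of S "2 * n + 1"])
      (simp_all add: S frag_of_mset_in_quotient_iff)
  then show "x \<in> B_pm TYPE('a)"
    by (simp add: S frag_of_mset_in_B_pm_iff)
qed (use subset_seminormal_closure[OF is_submonoid_B_pm] in blast)

text \<open>
For \<open>S = g (3g)\<close> the signed sums are \<open>\<plusminus>4g\<close> and \<open>\<plusminus>2g\<close>, while in \<open>S\<^sup>3\<close> there is the relation
\<open>(g + g + g - 3g) + (3g - 3g) = 0\<close>. Hence all powers of \<open>S\<close> except possibly \<open>S\<close> itself are zero-sum.
\<close>

lemma four_annihilates_if_seminormal:
  assumes semi: "seminormal (B_pm TYPE('a::ab_group_add))"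
  shows "nat_mult 4 (g :: 'a) = 0"
proof -
  define S where "S = {#g, g + g + g#}"
  have sum: "sum_mset S = (g + g) + (g + g)"
    by (simp add: S_def add.assoc)
  have "0 \<in> signed_sums (repeat_mset m S)" if "m \<ge> 2" for m
  proof (cases "even m")
    case True
    then show ?thesis by (rule zero_in_signed_sums_repeat_even)
  next
    case False
    then have "m = 3 + (m - 3)" "even (m - 3)"
      using that by (auto elim!: oddE)
    then have split: "repeat_mset m S = repeat_mset 3 S + repeat_mset (m - 3) S"
      and even: "0 \<in> signed_sums (repeat_mset (m - 3) S)"
      by (metis repeat_mset_distrib, metis zero_in_signed_sums_repeat_even)
    \<comment> \<open>Two of the three letters 3g get a negative sign: the total sum is 12g = 2(3g + 3g).\<close>
    have "{#g + g + g, g + g + g#} \<subseteq># repeat_mset 3 S"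
      by (simp add: S_def eval_nat_numeral)
    moreover have "sum_mset (repeat_mset 3 S) = (\<Sum>h\<in>#{#g + g + g, g + g + g#}. h + h)"
      by (simp add: S_def eval_nat_numeral ac_simps)
    ultimately have "0 \<in> signed_sums (repeat_mset 3 S)"
      unfolding zero_in_signed_sums_iff by blast
    then show ?thesis
      unfolding split using signed_sums_subset_union[OF even] by blast
  qed
  then have "nat_mult m (frag_of_mset S) \<in> B_pm TYPE('a)" if "m \<ge> 2" for m
    using that by (simp add: nat_mult_frag_of_mset frag_of_mset_in_B_pm_iff)
  moreover have "frag_of_mset S \<in> quotient_group (B_pm TYPE('a))"
    unfolding frag_of_mset_in_quotient_iff sum mem_double_UNIV by blast
  ultimately have "frag_of_mset S \<in> seminormal_closure (B_pm TYPE('a))"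
    unfolding seminormal_closure_def by (auto intro!: exI[of _ 2])
  then have "0 \<in> signed_sums S"
    using semi unfolding seminormal_def frag_of_mset_in_B_pm_iff[symmetric] by simp
  then have "(g + g) + (g + g) = 0 \<or> g + g = 0"
    by (auto simp: S_def signed_sums_add_mset algebra_simps eq_neg_iff_add_eq_0)
  then show ?thesis
    by (auto simp: nat_mult_4)
qed

theorem theorem3p4:
  shows "(mori_monoid (B_pm TYPE('a::ab_group_add)) \<longleftrightarrow>
            colon (B_pm TYPE('a)) (B_pm TYPE('a))
              (complete_integral_closure (B_pm TYPE('a))) \<noteq> {}) \<and>
         (colon (B_pm TYPE('a)) (B_pm TYPE('a))
              (complete_integral_closure (B_pm TYPE('a))) \<noteq> {} \<longleftrightarrow>
            finite (double (UNIV :: 'a set))) \<and>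
         (finite (double (UNIV :: 'a set)) \<longleftrightarrow>
            (\<exists>G1 G2 :: 'a set. direct_sum UNIV G1 G2 \<and> elementary_2_group G1 \<and> finite G2)) \<and>
         (mori_monoid (B_pm TYPE('a)) \<longrightarrow>
            (seminormal (B_pm TYPE('a)) \<longleftrightarrow> exponent (UNIV :: 'a set) dvd 4))"
proof -
  have "mori_monoid (B_pm TYPE('a)) \<longleftrightarrow> finite (double (UNIV :: 'a set))"
    using mori_if_finite_double finite_double_if_mori by blast
  moreover have "seminormal (B_pm TYPE('a)) \<longleftrightarrow> exponent (UNIV :: 'a set) dvd 4"
    unfolding exponent_dvd_4_iff using seminormal_if_four_annihilates four_annihilates_if_seminormal by blast
  ultimately show ?thesis
    using conductor_nonempty_iff finite_double_iff_direct_sum by blast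
qed

end
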